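(* Let $D$ be a unique factorization domain, let $n \in D$ be such that $\langle n \rangle$ is a nontrivial principal ideal of $D$ (that is, $n$ is nonzero and not a unit), and let $\phi : D \to D/\langle n \rangle$ be the canonical homomorphism. Let $\mathfrak{B}$ be a zero-divisor basis for $D/\langle n \rangle$. Then: (1) each vertex of the compressed zero-divisor graph $\Gamma_C(D/\langle n \rangle)$ is the equivalence class $[\phi(d)]$ of exactly one $d \in \mathfrak{B}$; (2) for $d_1, d_2 \in \mathfrak{B}$ such that $[\phi(d_1)]$ and $[\phi(d_2)]$ are distinct vertices of $\Gamma_C(D/\langle n \rangle)$, there is an edge between $[\phi(d_1)]$ and $[\phi(d_2)]$ if and only if $d_1 d_2 \in \langle n \rangle$.
   Context: For a commutative ring $R$, $Z(R)$ denotes the set of zero-divisors: $r \in Z(R)$ if and only if there is $s \in R$, $s \neq 0$, with $rs = 0$. For $r \in R$, $\mathrm{ann}(r) = \{x \in R : rx = 0\}$. Write $r \sim s$ if $\mathrm{ann}(r) = \mathrm{ann}(s)$, and let $[r]$ denote the equivalence class of $r$. The compressed zero-divisor graph $\Gamma_C(R)$ is the simple (loopless, undirected) graph with vertex set $\{[r] : r \in Z(R),\ r \neq 0\}$, in which two distinct classes $[r], [s]$ are adjacent if and only if $xy = 0$ for all $x \in [r]$, $y \in [s]$ (equivalently, $rs = 0$). A zero-divisor basis $\mathfrak{B}$ for $D/\langle n \rangle$ is a set of all nontrivial divisors of $n$ up to associates: every $d \in \mathfrak{B}$ divides $n$, is not a unit, and is not an associate of $n$; no two distinct elements of $\mathfrak{B}$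 are associates; and every divisor of $n$ that is neither a unit nor an associate of $n$ is an associate of some element of $\mathfrak{B}$. *)

theory Defs
  imports "HOL-Algebra.Algebra"
begin

definition annihilator :: "('a, 'b) ring_scheme \<Rightarrow> 'a \<Rightarrow> 'a set" where
  "annihilator R r = {x \<in> carrier R. r \<otimes>\<^bsub>R\<^esub> x = \<zero>\<^bsub>R\<^esub>}"

text \<open>Zero counts as a zero-divisor of a nonzero ring.\<close>

definition zero_divisors :: "('a, 'b) ring_scheme \<Rightarrow> 'a set" where
  "zero_divisors R =
    {r \<in> carrier R. \<exists>s \<in> carrier R. s \<noteq> \<zero>\<^bsub>R\<^esub> \<and> r \<otimes>\<^bsub>R\<^esub> s = \<zero>\<^bsub>R\<^esub>}"

text \<open>The equivalence class of an element is taken in the whole ring.\<close>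

definition ann_class :: "('a, 'b) ring_scheme \<Rightarrow> 'a \<Rightarrow> 'a set" where
  "ann_class R r = {s \<in> carrier R. annihilator R s = annihilator R r}"

text \<open>
  An undirected graph without loops or multiple edges: an edge is the
  two-element set of its endpoints.
\<close>

record 'v ugraph =
  verts :: "'v set"
  edges :: "'v set set"

definition simple_graph :: "'v ugraph \<Rightarrow> bool" where
  "simple_graph G \<longleftrightarrow> (\<forall>e \<in> edges G. e \<subseteq> verts G \<and> card e = 2)"

definition compressed_zero_divisor_graph :: "('a, 'b) ring_scheme \<Rightarrow> 'a set ugraph" where
  "compressed_zero_divisor_graph R =
    (let V = {ann_class R r |r. r \<in> zero_divisors R \<and> r \<noteq> \<zero>\<^bsub>R\<^esub>}
     in \<lparr>verts = V,
         edges = {{S, T} |S T. S \<in> V \<and> T \<in> V \<and> S \<noteq> T \<and>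
                    (\<forall>x \<in> S. \<forall>y \<in> T. x \<otimes>\<^bsub>R\<^esub> y = \<zero>\<^bsub>R\<^esub>)}\<rparr>)"

lemma simple_graph_compressed_zero_divisor_graph:
  "simple_graph (compressed_zero_divisor_graph R)"
  by (auto simp: simple_graph_def compressed_zero_divisor_graph_def Let_def card_2_iff)

lemma (in cring) ann_class_mult_zero_iff:
  assumes r: "r \<in> carrier R" and s: "s \<in> carrier R"
  shows "(\<forall>x \<in> ann_class R r. \<forall>y \<in> ann_class R s. x \<otimes> y = \<zero>) \<longleftrightarrow> r \<otimes> s = \<zero>"
proof
  assume "\<forall>x \<in> ann_class R r. \<forall>y \<in> ann_class R s. x \<otimes> y = \<zero>"
  with r s show "r \<otimes> s = \<zero>" by (simp add: ann_class_def)
next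
  assume rs: "r \<otimes> s = \<zero>"
  show "\<forall>x \<in> ann_class R r. \<forall>y \<in> ann_class R s. x \<otimes> y = \<zero>"
  proof (intro ballI)
    fix x y assume x: "x \<in> ann_class R r" and y: "y \<in> ann_class R s"
    from x y have xc: "x \<in> carrier R" and yc: "y \<in> carrier R"
      by (auto simp: ann_class_def)
    from rs s x have "s \<in> annihilator R x"
      by (simp add: ann_class_def annihilator_def)
    with xc s have "x \<in> annihilator R s"
      by (simp add: annihilator_def m_comm)
    with y have "x \<in> annihilator R y"
      by (simp add: ann_class_def)
    with xc yc show "x \<otimes> y = \<zero>"
      by (simp add: annihilator_def m_comm)
  qed
qed

definition zero_divisor_basis :: "('a, 'b) ring_scheme \<Rightarrow> 'a \<Rightarrow> 'a set \<Rightarrow> bool" where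
  "zero_divisor_basis D n B \<longleftrightarrow>
    (\<forall>d \<in> B. d \<in> carrier D \<and> d divides\<^bsub>D\<^esub> n \<and> d \<notin> Units D \<and> \<not> d \<sim>\<^bsub>D\<^esub> n) \<and>
    (\<forall>d \<in> B. \<forall>d' \<in> B. d \<noteq> d' \<longrightarrow> \<not> d \<sim>\<^bsub>D\<^esub> d') \<and>
    (\<forall>c \<in> carrier D. c divides\<^bsub>D\<^esub> n \<and> c \<notin> Units D \<and> \<not> c \<sim>\<^bsub>D\<^esub> n \<longrightarrow>
       (\<exists>d \<in> B. c \<sim>\<^bsub>D\<^esub> d))"

end

theory Submission
  imports Defs
begin

text \<open>
  The annihilator of \<open>\<phi> a\<close> is determined by the set of \<open>x\<close> with \<open>n dvd a x\<close>.  Since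
  \<open>gcd(a x, n x)\<close> is an associate of \<open>gcd(a, n) x\<close>, replacing \<open>a\<close> by the divisor \<open>gcd(a, n)\<close> of
  \<open>n\<close> does not change this set.  Conversely a divisor \<open>d\<close> of \<open>n = d e\<close> is recovered from the set
  up to associates: if \<open>e\<close> belongs to the set of \<open>d'\<close>, then \<open>d e\<close> divides \<open>d' e\<close>, and
  cancelling \<open>e\<close> gives \<open>d dvd d'\<close>.
\<close>

lemma (in cring) mem_cgenideal_iff_divides:
  assumes "a \<in> carrier R" "b \<in> carrier R"
  shows "b \<in> PIdl a \<longleftrightarrow> a divides b"
  using assms by (auto simp: cgenideal_def factor_def m_comm)

lemma (in cring) rcos_cgenideal_eq_zero_iff:
  assumes "n \<in> carrier R" "a \<in> carrier R"
  shows "PIdl n +> a = \<zero>\<^bsub>R Quot PIdl n\<^esub> \<longleftrightarrow> n divides a"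
proof -
  interpret I: ideal "PIdl n" R by (rule cgenideal_ideal[OF assms(1)])
  have "PIdl n +> a = PIdl n \<longleftrightarrow> a \<in> PIdl n"
    using I.a_rcos_const I.rcos_const_imp_mem assms(2) by blast
  then show ?thesis
    using mem_cgenideal_iff_divides[OF assms] by (simp add: FactRing_def)
qed

lemma (in cring) rcos_cgenideal_mult_eq_zero_iff:
  assumes "n \<in> carrier R" "a \<in> carrier R" "b \<in> carrier R"
  shows "(PIdl n +> a) \<otimes>\<^bsub>R Quot PIdl n\<^esub> (PIdl n +> b) = \<zero>\<^bsub>R Quot PIdl n\<^esub>
    \<longleftrightarrow> n divides a \<otimes> b"
proof -
  interpret I: ideal "PIdl n" R by (rule cgenideal_ideal[OF assms(1)])
  have "(PIdl n +> a) \<otimes>\<^bsub>R Quot PIdl n\<^esub> (PIdl n +> b) = PIdl n +> (a \<otimes> b)"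
    using ring_hom_mult[OF I.rcos_ring_hom assms(2,3)] by simp
  then show ?thesis
    using assms by (simp add: rcos_cgenideal_eq_zero_iff)
qed

lemma carrier_FactRing: "carrier (R Quot I) = (\<lambda>a. I +>\<^bsub>R\<^esub> a) ` carrier R"
  by (auto simp: FactRing_simps)

text \<open>Each element lies in its own class, so equal classes mean equal annihilators. Every
  element of the quotient is a coset, so annihilators can be compared on representatives, and a
  vanishing product of cosets becomes divisibility by \<open>n\<close>.\<close>

lemma (in cring) ann_class_rcos_eq_iff:
  assumes n: "n \<in> carrier R" and a: "a \<in> carrier R" and b: "b \<in> carrier R"
  shows "ann_class (R Quot PIdl n) (PIdl n +> a) = ann_class (R Quot PIdl n) (PIdl n +> b)
    \<longleftrightarrow> (\<forall>x \<in> carrier R. n divides a \<otimes> x \<longleftrightarrow> n divides b \<otimes> x)"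
proof -
  let ?Q = "R Quot PIdl n"
  have "PIdl n +> a \<in> carrier ?Q"
    using a by (simp add: carrier_FactRing)
  then have "ann_class ?Q (PIdl n +> a) = ann_class ?Q (PIdl n +> b)
      \<longleftrightarrow> annihilator ?Q (PIdl n +> a) = annihilator ?Q (PIdl n +> b)"
    by (auto simp: ann_class_def)
  also have "\<dots> \<longleftrightarrow> (\<forall>Y \<in> carrier ?Q. (PIdl n +> a) \<otimes>\<^bsub>?Q\<^esub> Y = \<zero>\<^bsub>?Q\<^esub>
      \<longleftrightarrow> (PIdl n +> b) \<otimes>\<^bsub>?Q\<^esub> Y = \<zero>\<^bsub>?Q\<^esub>)"
    by (auto simp: annihilator_def)
  also have "\<dots> \<longleftrightarrow> (\<forall>x \<in> carrier R. n divides a \<otimes> x \<longleftrightarrow> n divides b \<otimes> x)"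
    using n a b by (simp add: carrier_FactRing rcos_cgenideal_mult_eq_zero_iff)
  finally show ?thesis .
qed

lemma (in cring) divides_mult_right_cong:
  assumes "a \<in> carrier R" "b \<in> carrier R" "x \<in> carrier R" "n \<in> carrier R" "a divides b" "n divides a \<otimes> x"
  shows "n divides b \<otimes> x"
  using assms by (metis divides_mult divides_trans m_comm)

lemma (in domain) divides_if_same_multipliers:
  assumes n: "n \<in> carrier R" "n \<noteq> \<zero>"
    and d: "d \<in> carrier R" "d divides n" and d': "d' \<in> carrier R"
    and eq: "\<forall>x \<in> carrier R. n divides d \<otimes> x \<longleftrightarrow> n divides d' \<otimes> x"
  shows "d divides d'"
proof -
  obtain e where e: "e \<in> carrier R" "n = d \<otimes> e"
    using d(2) by (auto simp: factor_def)
  \<comment> \<open>Cancelling the cofactor \<open>e\<close> requires it to be nonzero; this is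
    where \<open>n\<close> being nonzero enters.\<close>
  have "e \<noteq> \<zero>" using e(2) n(2) r_null[OF d(1)] by blast
  \<comment> \<open>Here \<open>eq\<close> is instantiated with \<open>x = e\<close>: its left side
    holds because \<open>n\<close> is \<open>d \<otimes> e\<close> itself.\<close>
  moreover have "e \<otimes> d divides e \<otimes> d'"
    using eq e d(1) d' n(1) by (metis divides_refl m_comm)
  ultimately show ?thesis
    using mult_divides[OF d(1) d'] e(1) by blast
qed

text \<open>The witness is a gcd of \<open>a\<close> and \<open>n\<close>, formed in the monoid
  \<open>mult_of R\<close> of nonzero elements, hence the restriction to nonzero \<open>a\<close>.
  That \<open>d\<close> also divides \<open>a\<close> is recorded because it later rules out
  \<open>d\<close> being an associate of \<open>n\<close>.\<close>

lemma (in factorial_domain) exists_divisor_same_multipliers: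
  assumes n: "n \<in> carrier R" "n \<noteq> \<zero>" and a: "a \<in> carrier R" "a \<noteq> \<zero>"
  obtains d where "d \<in> carrier R" "d divides n" "d divides a"
    "\<And>x. x \<in> carrier R \<Longrightarrow> n divides a \<otimes> x \<longleftrightarrow> n divides d \<otimes> x"
proof -
  let ?M = "mult_of R"
  let ?d = "somegcd ?M a n"
  have aM: "a \<in> carrier ?M" and nM: "n \<in> carrier ?M" using a n by auto
  have dM: "?d \<in> carrier ?M" using gcd_closed[OF aM nM] .
  then have d: "?d \<in> carrier R" by simp
  have da: "?d divides a" and dn: "?d divides n"
    using gcd_divides_l[OF aM nM] gcd_divides_r[OF aM nM]
    by (blast intro: divides_mult_imp_divides)+
  have "n divides ?d \<otimes> x" if x: "x \<in> carrier R" and dvd: "n divides a \<otimes> x" for x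
  \<comment> \<open>Zero is not an element of \<open>mult_of R\<close>, so the gcd argument covers
    only nonzero \<open>x\<close>.\<close>
  proof (cases "x = \<zero>")
    case True
    then show ?thesis using d n by (simp add: divides_zero)
  next
    case False
    then have xM: "x \<in> carrier ?M" using x by simp
    have xa: "x \<otimes> a \<in> carrier ?M" and xn: "x \<otimes> n \<in> carrier ?M"
      using mult_of.m_closed[OF xM aM] mult_of.m_closed[OF xM nM] by simp_all
    have "n divides\<^bsub>?M\<^esub> x \<otimes> a"
      using dvd xa n(1) m_comm[OF x a(1)] by simp
    moreover have "n divides\<^bsub>?M\<^esub> x \<otimes> n"
      using dividesI'[OF m_comm[OF x n(1)] x] xn n(1) by simp
    ultimately have "n divides\<^bsub>?M\<^esub> somegcd ?M (x \<otimes> a) (x \<otimes> n)"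
      using gcd_divides xa xn nM by blast
    \<comment> \<open>Multiplication by \<open>x\<close> commutes with gcds up to associates, and
      one half of that association suffices.\<close>
    moreover have "somegcd ?M (x \<otimes> a) (x \<otimes> n) divides\<^bsub>?M\<^esub> x \<otimes> ?d"
      using gcd_mult[OF aM nM xM] by (simp add: associated_def)
    ultimately have "n divides x \<otimes> ?d"
      by (rule divides_mult_imp_divides[OF mult_of.divides_trans[OF _ _ nM]])
    then show ?thesis using m_comm[OF x d] by simp
  qed
  then show thesis
    \<comment> \<open>The converse direction needs no gcd property beyond \<open>?d\<close> dividing
      \<open>a\<close>.\<close>
    using that[OF d dn da] divides_mult_right_cong[OF d a(1) _ n(1) da] by blast
qed

text \<open>Leaves the vertex set folded, so that assumptions about \<open>verts\<close> apply as
  they stand.\<close>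

lemma edges_compressed_zero_divisor_graph:
  "edges (compressed_zero_divisor_graph R) =
    {{S, T} |S T. S \<in> verts (compressed_zero_divisor_graph R) \<and>
      T \<in> verts (compressed_zero_divisor_graph R) \<and> S \<noteq> T \<and>
      (\<forall>x \<in> S. \<forall>y \<in> T. x \<otimes>\<^bsub>R\<^esub> y = \<zero>\<^bsub>R\<^esub>)}"
  by (simp add: compressed_zero_divisor_graph_def Let_def)

lemma (in cring) rcos_edge_iff:
  fixes n a b
  defines "Q \<equiv> R Quot PIdl n"
  defines "A \<equiv> ann_class Q (PIdl n +> a)" and "B \<equiv> ann_class Q (PIdl n +> b)"
  assumes n: "n \<in> carrier R" and a: "a \<in> carrier R" and b: "b \<in> carrier R"
    and av: "A \<in> verts (compressed_zero_divisor_graph Q)"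
    and bv: "B \<in> verts (compressed_zero_divisor_graph Q)"
    and neq: "A \<noteq> B"
  shows "{A, B} \<in> edges (compressed_zero_divisor_graph Q) \<longleftrightarrow> a \<otimes> b \<in> PIdl n"
proof -
  interpret Q: cring Q
    unfolding Q_def by (intro ideal.quotient_is_cring cgenideal_ideal n is_cring)
  let ?ann = "\<lambda>S T. \<forall>x \<in> S. \<forall>y \<in> T. x \<otimes>\<^bsub>Q\<^esub> y = \<zero>\<^bsub>Q\<^esub>"
  have aQ: "PIdl n +> a \<in> carrier Q" and bQ: "PIdl n +> b \<in> carrier Q"
    using a b by (simp_all add: Q_def carrier_FactRing)
  \<comment> \<open>An edge is an unordered pair, so its membership in the edge set may be witnessed
    by \<open>A\<close> and \<open>B\<close> in either order; symmetry makes both readings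
    agree.\<close>
  have "?ann B A \<longleftrightarrow> ?ann A B"
    unfolding A_def B_def
    using Q.ann_class_mult_zero_iff aQ bQ Q.m_comm[OF aQ bQ] by simp
  then have "{A, B} \<in> edges (compressed_zero_divisor_graph Q) \<longleftrightarrow> ?ann A B"
    using av bv neq unfolding edges_compressed_zero_divisor_graph by (auto simp: doubleton_eq_iff)
  also have "\<dots> \<longleftrightarrow> n divides a \<otimes> b"
    unfolding A_def B_def Q.ann_class_mult_zero_iff[OF aQ bQ]
    unfolding Q_def by (rule rcos_cgenideal_mult_eq_zero_iff[OF n a b])
  also have "\<dots> \<longleftrightarrow> a \<otimes> b \<in> PIdl n"
    using mem_cgenideal_iff_divides n a b by simp
  finally show ?thesis .
qed

lemma (in factorial_domain) vertex_ex1_basis: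
  fixes n
  defines "Q \<equiv> R Quot PIdl n"
  assumes n: "n \<in> carrier R" "n \<noteq> \<zero>" and B: "zero_divisor_basis R n B"
    and v: "v \<in> verts (compressed_zero_divisor_graph Q)"
  shows "\<exists>!d. d \<in> B \<and> v = ann_class Q (PIdl n +> d)"
proof -
  note class_eq = ann_class_rcos_eq_iff[OF n(1), folded Q_def]
  note zero_iff = rcos_cgenideal_eq_zero_iff[OF n(1), folded Q_def]
  note mult_zero_iff = rcos_cgenideal_mult_eq_zero_iff[OF n(1), folded Q_def]
  have Bd: "d \<in> carrier R" "d divides n" if "d \<in> B" for d
    using B that by (auto simp: zero_divisor_basis_def)
  obtain r where r: "r \<in> zero_divisors Q" "r \<noteq> \<zero>\<^bsub>Q\<^esub>" "v = ann_class Q r"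
    using v by (auto simp: compressed_zero_divisor_graph_def Let_def)
  then obtain s where s: "r \<in> carrier Q" "s \<in> carrier Q" "s \<noteq> \<zero>\<^bsub>Q\<^esub>" "r \<otimes>\<^bsub>Q\<^esub> s = \<zero>\<^bsub>Q\<^esub>"
    by (auto simp: zero_divisors_def)
  then obtain a b where ab: "a \<in> carrier R" "r = PIdl n +> a" "b \<in> carrier R" "s = PIdl n +> b"
    by (auto simp: Q_def carrier_FactRing)
  have na: "\<not> n divides a" and nb: "\<not> n divides b" and nab: "n divides a \<otimes> b"
    using r(2) s(3,4) ab zero_iff mult_zero_iff by auto
  \<comment> \<open>Since \<open>n\<close> divides zero, a nonzero coset has a nonzero
    representative.\<close>
  have "a \<noteq> \<zero>" using na n(1) divides_zero by blast
  then obtain c where c: "c \<in> carrier R" "c divides n" "c divides a"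
      "\<And>x. x \<in> carrier R \<Longrightarrow> n divides a \<otimes> x \<longleftrightarrow> n divides c \<otimes> x"
    using exists_divisor_same_multipliers[OF n ab(1)] by metis
  \<comment> \<open>If \<open>c\<close> were a unit, then \<open>n\<close> dividing
    \<open>c \<otimes> b\<close> would force \<open>n\<close> to divide \<open>b\<close>, making
    \<open>s\<close> zero.\<close>
  have "c \<notin> Units R"
  proof
    assume "c \<in> Units R"
    then have "c divides \<one>" using divides_one[OF c(1)] by simp
    moreover have "n divides c \<otimes> b" using c(4) ab(3) nab by simp
    ultimately have "n divides \<one> \<otimes> b"
      using divides_mult_right_cong[OF c(1) one_closed ab(3) n(1)] by blast
    then show False using nb ab(3) by simp
  qed
  \<comment> \<open>Otherwise \<open>n\<close> would divide \<open>c\<close> and hence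
    \<open>a\<close>, making \<open>r\<close> zero.\<close>
  moreover have "\<not> c \<sim> n"
    using na c(3) n(1) ab(1) divides_trans by (auto simp: associated_def)
  ultimately obtain d where d: "d \<in> B" "c \<sim> d"
    using B c(1,2) by (auto simp: zero_divisor_basis_def)
  \<comment> \<open>Replacing \<open>c\<close> by its associate \<open>d\<close> in the basis does
    not change the class, as divisibility both ways carries the condition across.\<close>
  have "n divides c \<otimes> x \<longleftrightarrow> n divides d \<otimes> x" if "x \<in> carrier R" for x
    using divides_mult_right_cong[OF c(1) Bd(1)[OF d(1)] that n(1)]
      divides_mult_right_cong[OF Bd(1)[OF d(1)] c(1) that n(1)] d(2)
    by (meson associated_def)
  then have vd: "v = ann_class Q (PIdl n +> d)"
    unfolding r(3) ab(2) class_eq[OF ab(1) Bd(1)[OF d(1)]] using c(4) by simp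
  show ?thesis
  proof (rule ex1I[of _ d])
    show "d \<in> B \<and> v = ann_class Q (PIdl n +> d)" using d(1) vd by simp
  next
    fix d' assume d': "d' \<in> B \<and> v = ann_class Q (PIdl n +> d')"
    then have "\<forall>x \<in> carrier R. n divides d \<otimes> x \<longleftrightarrow> n divides d' \<otimes> x"
      using vd class_eq Bd d(1) by auto
    \<comment> \<open>Both elements divide \<open>n\<close>, so the cancellation lemma applies in
      each direction; distinct members of the basis are never associates.\<close>
    then have "d \<sim> d'"
      using divides_if_same_multipliers[OF n] Bd d(1) d' by (simp add: associated_def)
    then show "d' = d"
      using B d(1) d' by (auto simp: zero_divisor_basis_def)
  qed
qed

theorem theorem6:
  fixes D :: "('a, 'b) ring_scheme" (structure)
    and R :: "'a set ring"
    and n :: 'a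
    and \<phi> :: "'a \<Rightarrow> 'a set"
    and B :: "'a set"
  assumes "factorial_domain D"
    and "n \<in> carrier D" and "n \<noteq> \<zero>" and "n \<notin> Units D"
    and "R = D Quot (PIdl n)"
    and "\<phi> = (\<lambda>a. PIdl n +> a)"
    and "zero_divisor_basis D n B"
  shows "(\<forall>v \<in> verts (compressed_zero_divisor_graph R). \<exists>!d. d \<in> B \<and> v = ann_class R (\<phi> d)) \<and>
    (\<forall>d\<^sub>1 \<in> B. \<forall>d\<^sub>2 \<in> B.
       ann_class R (\<phi> d\<^sub>1) \<in> verts (compressed_zero_divisor_graph R) \<longrightarrow>
       ann_class R (\<phi> d\<^sub>2) \<in> verts (compressed_zero_divisor_graph R) \<longrightarrow>
       ann_class R (\<phi> d\<^sub>1) \<noteq> ann_class R (\<phi> d\<^sub>2) \<longrightarrow>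
       ({ann_class R (\<phi> d\<^sub>1), ann_class R (\<phi> d\<^sub>2)} \<in> edges (compressed_zero_divisor_graph R)
          \<longleftrightarrow> d\<^sub>1 \<otimes> d\<^sub>2 \<in> PIdl n))"
proof (intro conjI ballI impI)
  interpret factorial_domain D by fact
  note R_def = \<open>R = D Quot (PIdl n)\<close> and \<phi>_def = \<open>\<phi> = (\<lambda>a. PIdl n +> a)\<close>
  show "\<exists>!d. d \<in> B \<and> v = ann_class R (\<phi> d)"
    if "v \<in> verts (compressed_zero_divisor_graph R)" for v
    using vertex_ex1_basis[OF assms(2,3,7) that[unfolded R_def]] unfolding R_def \<phi>_def .
  fix d\<^sub>1 d\<^sub>2
  assume "d\<^sub>1 \<in> B" "d\<^sub>2 \<in> B"
    and vs: "ann_class R (\<phi> d\<^sub>1) \<in> verts (compressed_zero_divisor_graph R)"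
      "ann_class R (\<phi> d\<^sub>2) \<in> verts (compressed_zero_divisor_graph R)"
      "ann_class R (\<phi> d\<^sub>1) \<noteq> ann_class R (\<phi> d\<^sub>2)"
  then have "d\<^sub>1 \<in> carrier D" "d\<^sub>2 \<in> carrier D"
    using assms(7) by (simp_all add: zero_divisor_basis_def)
  from rcos_edge_iff[OF assms(2) this vs[unfolded R_def \<phi>_def]]
  show "{ann_class R (\<phi> d\<^sub>1), ann_class R (\<phi> d\<^sub>2)} \<in> edges (compressed_zero_divisor_graph R)
      \<longleftrightarrow> d\<^sub>1 \<otimes> d\<^sub>2 \<in> PIdl n"
    unfolding R_def \<phi>_def .
qed

end
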